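(* Let $M$ and $N$ be two weighted means, let $A$ be the weighted arithmetic mean (all three of the same direction), and let $I\subseteq(0,\infty)$ and $J\subseteq(0,\infty)$ be intervals. Suppose $M\le A$ and $N\le A$, i.e. $M(u,v,\lambda)\le A(u,v,\lambda)$ and $N(u,v,\lambda)\le A(u,v,\lambda)$ for all $u,v\in(0,\infty)$, $\lambda\in[0,1]$. If $f:I\to J$ is $MN$-convex, then $f$ satisfies a Lipschitz condition on any closed interval $[a,b]$ contained in the interior $I^\circ$ of $I$. Consequently, $f$ is absolutely continuous on each such $[a,b]$ and continuous on $I^\circ$.
   Context: A function $M:(0,\infty)\times(0,\infty)\times[0,1]\to(0,\infty)$ is called a weighted mean if the following hold. (WM1) $M(u,v,\lambda)=M(v,u,1-\lambda)$. (WM2) $M(u,u,\lambda)=u$. (WM3) $u<M(u,v,\lambda)<v$ whenever $u<v$ and $\lambda\in(0,1)$. (WM4) $M(\alpha u,\alpha v,\lambda)=\alpha M(u,v,\lambda)$ for all $\alpha>0$. (WM5) For fixed $\lambda\in[0,1]$: $M(u,v,\lambda)\le M(w,v,\lambda)$ whenever $u\le w$, and $M(u,v,\lambda)\le M(u,w,\lambda)$ whenever $v\le w$. (WM6) For fixed $u\ne v$, $M(u,v,\cdot)$ is strictly monotone and continuous on $[0,1]$ with range $[\min\{u,v\},\max\{u,v\}]$. Moreover $M$ has a direction: either $M(u,v,\cdot)$ is strictly increasing for all $u<v$ (positive direction; then $M(u,v,0)=u$, $M(u,v,1)=v$ for all $u,v$), or $M(u,v,\cdot)$ is strictly decreasing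 for all $u<v$ (negative direction; then $M(u,v,0)=v$, $M(u,v,1)=u$ for all $u,v$). (WM7) $M(M(u,v,\lambda),M(z,w,\lambda),s)=M(M(u,z,s),M(v,w,s),\lambda)$ for all $u,v,z,w>0$, $s,\lambda\in[0,1]$. (WM8) For all $u,v>0$, $s,\lambda_1,\lambda_2\in[0,1]$: $M(M(u,v,\lambda_1),M(u,v,\lambda_2),s)$ equals $M(u,v,s\lambda_1+(1-s)\lambda_2)$ if $M$ has negative direction, and $M(u,v,(1-s)\lambda_1+s\lambda_2)$ if $M$ has positive direction. Standing assumption: all weighted means occurring together have the same direction. Thus the weighted arithmetic mean is $A(u,v,\lambda)=(1-\lambda)u+\lambda v$ if the common direction is positive, and $A(u,v,\lambda)=\lambda u+(1-\lambda)v$ if it is negative. For weighted means $M,N$ and intervals $I,J\subseteq(0,\infty)$, a function $f:I\to J$ is $MN$-convex if $f(M(u,v,\lambda))\le N(f(u),f(v),\lambda)$ for all $u,v\in I$, $\lambda\in[0,1]$. *)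

theory Defs
  imports "HOL-Analysis.Analysis"
begin

text \<open>
  A weighted mean is a map defined on pairs of positive reals and a weight in [0,1]. It is modelled
  by a total function of three reals; its values outside that domain are never used.
\<close>

datatype direction = Positive | Negative

fun has_direction :: "direction \<Rightarrow> (real \<Rightarrow> real \<Rightarrow> real \<Rightarrow> real) \<Rightarrow> bool" where
  "has_direction Positive M \<longleftrightarrow> (\<forall>u v. 0 < u \<longrightarrow> u < v \<longrightarrow> strict_mono_on {0..1} (M u v))"
| "has_direction Negative M \<longleftrightarrow> (\<forall>u v. 0 < u \<longrightarrow> u < v \<longrightarrow> strict_antimono_on {0..1} (M u v))"

locale weighted_mean =
  fixes M :: "real \<Rightarrow> real \<Rightarrow> real \<Rightarrow> real"
  assumes pos: "\<lbrakk>u > 0; v > 0; l \<in> {0..1}\<rbrakk> \<Longrightarrow> M u v l > 0"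
    and WM1: "\<lbrakk>u > 0; v > 0; l \<in> {0..1}\<rbrakk> \<Longrightarrow> M u v l = M v u (1 - l)"
    and WM2: "\<lbrakk>u > 0; l \<in> {0..1}\<rbrakk> \<Longrightarrow> M u u l = u"
    and WM3: "\<lbrakk>u > 0; u < v; l \<in> {0<..<1}\<rbrakk> \<Longrightarrow> u < M u v l \<and> M u v l < v"
    and WM4: "\<lbrakk>u > 0; v > 0; l \<in> {0..1}; c > 0\<rbrakk> \<Longrightarrow> M (c * u) (c * v) l = c * M u v l"
    and WM5_left: "\<lbrakk>u > 0; v > 0; w > 0; l \<in> {0..1}; u \<le> w\<rbrakk> \<Longrightarrow> M u v l \<le> M w v l"
    and WM5_right: "\<lbrakk>u > 0; v > 0; w > 0; l \<in> {0..1}; v \<le> w\<rbrakk> \<Longrightarrow> M u v l \<le> M u w l"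
    and WM6_monotone: "\<lbrakk>u > 0; v > 0; u \<noteq> v\<rbrakk> \<Longrightarrow>
          strict_mono_on {0..1} (M u v) \<or> strict_antimono_on {0..1} (M u v)"
    and WM6_continuous: "\<lbrakk>u > 0; v > 0; u \<noteq> v\<rbrakk> \<Longrightarrow> continuous_on {0..1} (M u v)"
    and WM6_range: "\<lbrakk>u > 0; v > 0; u \<noteq> v\<rbrakk> \<Longrightarrow> M u v ` {0..1} = {min u v..max u v}"
    and WM6_direction: "has_direction Positive M \<or> has_direction Negative M"
    and WM7: "\<lbrakk>u > 0; v > 0; z > 0; w > 0; s \<in> {0..1}; l \<in> {0..1}\<rbrakk> \<Longrightarrow>
          M (M u v l) (M z w l) s = M (M u z s) (M v w s) l"
    and WM8_negative: "\<lbrakk>has_direction Negative M; u > 0; v > 0; s \<in> {0..1}; l1 \<in> {0..1}; l2 \<in> {0..1}\<rbrakk>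
          \<Longrightarrow> M (M u v l1) (M u v l2) s = M u v (s * l1 + (1 - s) * l2)"
    and WM8_positive: "\<lbrakk>has_direction Positive M; u > 0; v > 0; s \<in> {0..1}; l1 \<in> {0..1}; l2 \<in> {0..1}\<rbrakk>
          \<Longrightarrow> M (M u v l1) (M u v l2) s = M u v ((1 - s) * l1 + s * l2)"

text \<open>
  The boundary values at weights 0 and 1 belonging to each direction are not assumed: they follow
  from monotonicity and the range of the mean.
\<close>

lemma (in weighted_mean) positive_direction_endpoints:
  assumes "has_direction Positive M" "u > 0" "v > 0"
  shows "M u v 0 = u" "M u v 1 = v"
proof -
  have *: "M x y 0 = x \<and> M x y 1 = y" if xy: "0 < x" "x < y" for x y
  proof -
    have m: "M x y p \<le> M x y q" if "0 \<le> p" "p \<le> q" "q \<le> 1" for p q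
      using assms(1) xy that
      by (cases "p = q") (force simp: monotone_on_def intro: less_imp_le)+
    have r: "M x y ` {0..1} = {x..y}"
      using WM6_range[of x y] xy by simp
    obtain p where p: "p \<in> {0..1}" "M x y p = x"
      using r xy by (metis atLeastAtMost_iff imageE less_imp_le order_refl)
    obtain q where q: "q \<in> {0..1}" "M x y q = y"
      using r xy by (metis atLeastAtMost_iff imageE less_imp_le order_refl)
    have "M x y 0 \<in> {x..y}" "M x y 1 \<in> {x..y}"
      using r by (metis atLeastAtMost_iff imageI order_refl zero_le_one)+
    then show ?thesis
      using m[of 0 p] m[of q 1] p q by auto
  qed
  show "M u v 0 = u" "M u v 1 = v"
    using *[of u v] *[of v u] WM1[of u v 0] WM1[of u v 1] WM2[of u 0] WM2[of u 1] assms(2,3)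
    by (cases u v rule: linorder_cases; simp)+
qed

lemma (in weighted_mean) negative_direction_endpoints:
  assumes "has_direction Negative M" "u > 0" "v > 0"
  shows "M u v 0 = v" "M u v 1 = u"
proof -
  have *: "M x y 0 = y \<and> M x y 1 = x" if xy: "0 < x" "x < y" for x y
  proof -
    have m: "M x y q \<le> M x y p" if "0 \<le> p" "p \<le> q" "q \<le> 1" for p q
      using assms(1) xy that
      by (cases "p = q") (force simp: monotone_on_def intro: less_imp_le)+
    have r: "M x y ` {0..1} = {x..y}"
      using WM6_range[of x y] xy by simp
    obtain p where p: "p \<in> {0..1}" "M x y p = x"
      using r xy by (metis atLeastAtMost_iff imageE less_imp_le order_refl)
    obtain q where q: "q \<in> {0..1}" "M x y q = y"
      using r xy by (metis atLeastAtMost_iff imageE less_imp_le order_refl)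
    have "M x y 0 \<in> {x..y}" "M x y 1 \<in> {x..y}"
      using r by (metis atLeastAtMost_iff imageI order_refl zero_le_one)+
    then show ?thesis
      using m[of p 1] m[of 0 q] p q by auto
  qed
  show "M u v 0 = v" "M u v 1 = u"
    using *[of u v] *[of v u] WM1[of u v 0] WM1[of u v 1] WM2[of u 0] WM2[of u 1] assms(2,3)
    by (cases u v rule: linorder_cases; simp)+
qed

fun arith_mean :: "direction \<Rightarrow> real \<Rightarrow> real \<Rightarrow> real \<Rightarrow> real" where
  "arith_mean Positive u v l = (1 - l) * u + l * v"
| "arith_mean Negative u v l = l * u + (1 - l) * v"

definition MN_convex_on ::
  "real set \<Rightarrow> (real \<Rightarrow> real \<Rightarrow> real \<Rightarrow> real) \<Rightarrow> (real \<Rightarrow> real \<Rightarrow> real \<Rightarrow> real) \<Rightarrow> (real \<Rightarrow> real) \<Rightarrow> bool"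
  where "MN_convex_on I M N f \<longleftrightarrow>
    (\<forall>u\<in>I. \<forall>v\<in>I. \<forall>l\<in>{0..1}. f (M u v l) \<le> N (f u) (f v) l)"

text \<open>
  Absolute continuity of a real function on [a,b], with finite families of non-overlapping
  subintervals [s k, t k]; degenerate ones contribute nothing to either sum.
\<close>

definition absolutely_continuous_on :: "real \<Rightarrow> real \<Rightarrow> (real \<Rightarrow> real) \<Rightarrow> bool" where
  "absolutely_continuous_on a b f \<longleftrightarrow>
    (\<forall>\<epsilon>>0. \<exists>\<delta>>0. \<forall>(n::nat) s t.
       (\<forall>k<n. a \<le> s k \<and> s k \<le> t k \<and> t k \<le> b) \<longrightarrow>
       disjoint_family_on (\<lambda>k. {s k<..<t k}) {..<n} \<longrightarrow>
       (\<Sum>k<n. t k - s k) < \<delta> \<longrightarrow>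
       (\<Sum>k<n. \<bar>f (t k) - f (s k)\<bar>) < \<epsilon>)"

end

theory Submission
  imports Defs
begin

text \<open>
  Reversing the weight turns a negative direction into a positive one. For positive direction,
  convexity of f gives f (M u v l) \<le> (1 - l) f u + l f v. Decreasing increments of f are then
  controlled by M \<le> A alone, with u < a fixed in I. Increasing increments require
  a bound M x (r x) l \<ge> x (1 + c l) with c > 0; by homogeneity only x = 1 matters. There l \<mapsto> M (1/r) r l
  is convex by (WM8) and M \<le> A, and strictly increasing, so its slope is bounded away from 0 to the
  right of the interior parameter at which it takes the value 1.
\<close>

section \<open>Reversal of the weight\<close>

lemma has_direction_reverse:
  "has_direction Positive (\<lambda>u v l. M u v (1 - l)) \<longleftrightarrow> has_direction Negative M"
  "has_direction Negative (\<lambda>u v l. M u v (1 - l)) \<longleftrightarrow> has_direction Positive M"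
proof -
  have mono: "strict_mono_on {0..1::real} (\<lambda>l. g (1 - l))" if "strict_antimono_on {0..1} g"
    for g :: "real \<Rightarrow> real"
    using that by (auto simp: monotone_on_def)
  have antimono: "strict_antimono_on {0..1::real} (\<lambda>l. g (1 - l))" if "strict_mono_on {0..1} g"
    for g :: "real \<Rightarrow> real"
    using that by (auto simp: monotone_on_def)
  have "strict_mono_on {0..1::real} (\<lambda>l. g (1 - l)) \<longleftrightarrow> strict_antimono_on {0..1} g"
    "strict_antimono_on {0..1::real} (\<lambda>l. g (1 - l)) \<longleftrightarrow> strict_mono_on {0..1} g"
    for g :: "real \<Rightarrow> real"
    using mono[of g] mono[of "\<lambda>l. g (1 - l)"] antimono[of g] antimono[of "\<lambda>l. g (1 - l)"] by auto
  then show "has_direction Positive (\<lambda>u v l. M u v (1 - l)) \<longleftrightarrow> has_direction Negative M"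
    "has_direction Negative (\<lambda>u v l. M u v (1 - l)) \<longleftrightarrow> has_direction Positive M"
    by simp_all
qed

text \<open>Each axiom is compatible with l \<mapsto> 1 - l. Since reversal swaps the directions,
  the two cases of WM8 change places: each is proved from the other one for \<open>M\<close>. This
  lets the main proof treat only positive direction.\<close>

lemma weighted_mean_reverse:
  assumes "weighted_mean M"
  shows "weighted_mean (\<lambda>u v l. M u v (1 - l))"
proof -
  interpret weighted_mean M by fact
  have refl: "(\<lambda>l. 1 - l) ` {0..1} = {0..1::real}"
    by (simp add: image_diff_atLeastAtMost)
  show ?thesis
  proof (unfold_locales, unfold has_direction_reverse)
    fix u v l :: real assume "u > 0" "v > 0" "l \<in> {0..1}"
    then show "M u v (1 - l) = M v u (1 - (1 - l))"
      using WM1[of u v "1 - l"] by simp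
  next
    fix u v :: real assume uv: "u > 0" "v > 0" "u \<noteq> v"
    have "strict_antimono_on {0..1} (\<lambda>l. M u v (1 - l))" if "strict_mono_on {0..1} (M u v)"
      using that by (auto simp: monotone_on_def)
    moreover have "strict_mono_on {0..1} (\<lambda>l. M u v (1 - l))" if "strict_antimono_on {0..1} (M u v)"
      using that by (auto simp: monotone_on_def)
    ultimately show "strict_mono_on {0..1} (\<lambda>l. M u v (1 - l)) \<or>
        strict_antimono_on {0..1} (\<lambda>l. M u v (1 - l))"
      using WM6_monotone[OF uv] by blast
    show "continuous_on {0..1} (\<lambda>l. M u v (1 - l))"
      by (rule continuous_on_compose2[OF WM6_continuous[OF uv]]) (auto intro!: continuous_intros)
    have "(\<lambda>l. M u v (1 - l)) ` {0..1} = M u v ` (\<lambda>l. 1 - l) ` {0..1}"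
      by (simp only: image_image)
    then show "(\<lambda>l. M u v (1 - l)) ` {0..1} = {min u v..max u v}"
      using WM6_range[OF uv] by (simp only: refl)
  next
    show "has_direction Negative M \<or> has_direction Positive M"
      using WM6_direction by blast
  next
    fix u v s l1 l2 :: real
    assume *: "u > 0" "v > 0" "s \<in> {0..1}" "l1 \<in> {0..1}" "l2 \<in> {0..1}"
    show "M (M u v (1 - l1)) (M u v (1 - l2)) (1 - s) = M u v (1 - (s * l1 + (1 - s) * l2))"
      if "has_direction Positive M"
      using WM8_positive[OF that, of u v "1 - s" "1 - l1" "1 - l2"] * by (simp add: algebra_simps)
    show "M (M u v (1 - l1)) (M u v (1 - l2)) (1 - s) = M u v (1 - ((1 - s) * l1 + s * l2))"
      if "has_direction Negative M"
      using WM8_negative[OF that, of u v "1 - s" "1 - l1" "1 - l2"] * by (simp add: algebra_simps)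
  qed (use pos WM2 WM3 WM4 WM5_left WM5_right WM7 in simp_all)
qed

section \<open>Means as parametrisations of an interval, and their slope\<close>

lemma (in weighted_mean) between_eq_mean:
  assumes "0 < u" "u < v" "u \<le> x" "x \<le> v"
  obtains l where "l \<in> {0..1}" "M u v l = x"
proof -
  have "x \<in> M u v ` {0..1}"
    using WM6_range[of u v] assms by simp
  then show thesis
    using that by blast
qed

text \<open>An upper bound M \<le> A yields a lower bound on \<open>M 1 r s\<close> only through a
  point to the left of 1. The chord from that point to \<open>M 1 r s\<close> passes through 1, and
  M \<le> A along it pushes its far end up.\<close>

lemma (in weighted_mean) mean_linear_lower_bound:
  assumes dir: "has_direction Positive M"
    and le: "\<And>u v l. \<lbrakk>u > 0; v > 0; l \<in> {0..1}\<rbrakk> \<Longrightarrow> M u v l \<le> (1 - l) * u + l * v"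
    and r: "r > 1"
  obtains c where "c > 0" "\<And>s. s \<in> {0..1} \<Longrightarrow> 1 + c * s \<le> M 1 r s"
proof -
  define q where "q = 1 / r"
  have q: "0 < q" "q < 1" "0 < r"
    using r by (auto simp: q_def)
  obtain l0 where l0: "l0 \<in> {0..1}" "M q r l0 = 1"
    using between_eq_mean[of q r 1] q r by auto
  have "l0 \<noteq> 0" "l0 \<noteq> 1"
    using l0 positive_direction_endpoints[OF dir, of q r] q r by auto
  then have l0': "0 < l0" "l0 < 1"
    using l0 by auto
  \<comment> \<open>The line through (0, q) and (l0, 1) has slope (1 - q) / l0; the factor 1 - l0 is
    the rate at which the parameter \<open>m\<close> below grows with \<open>s\<close>.\<close>
  define c where "c = (1 - q) * (1 - l0) / l0"
  have "1 + c * s \<le> M 1 r s" if s: "s \<in> {0..1}" for s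
  proof -
    \<comment> \<open>As 1 and \<open>r\<close> are the values of \<open>M q r\<close> at
      \<open>l0\<close> and 1, WM8 makes \<open>m\<close> the parameter of \<open>M 1 r s\<close> on
      this curve. The weight \<open>t\<close> places 1 between \<open>q\<close> and
      \<open>M q r m\<close>.\<close>
    define m where "m = (1 - s) * l0 + s"
    define t where "t = l0 / m"
    have eq: "m - l0 = s * (1 - l0)"
      by (simp add: m_def algebra_simps)
    have "m \<ge> l0"
      using eq s l0' by (smt (verit) atLeastAtMost_iff mult_nonneg_nonneg)
    moreover have "1 - m = (1 - s) * (1 - l0)"
      by (simp add: m_def algebra_simps)
    then have "m \<le> 1"
      using s l0' by (smt (verit) atLeastAtMost_iff mult_nonneg_nonneg)
    ultimately have m: "0 < m" "m \<in> {0..1}" "t \<in> {0..1}"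
      using l0' by (auto simp: t_def)
    have "M 1 r s = M q r m"
      using WM8_positive[OF dir, of q r s l0 1] positive_direction_endpoints[OF dir, of q r] q s l0
      by (simp add: m_def)
    moreover have "M q (M q r m) t = M q r (t * m)"
      using WM8_positive[OF dir, of q r t 0 m] positive_direction_endpoints[OF dir, of q r] q m
      by simp
    moreover have "t * m = l0"
      using m by (simp add: t_def)
    ultimately have "1 \<le> (1 - t) * q + t * M 1 r s"
      using le[of q "M q r m" t] pos[of q r m] q m l0 by simp
    then have "m * 1 \<le> m * ((1 - t) * q + t * M 1 r s)"
      using m by (intro mult_left_mono) auto
    also have "\<dots> = (m - t * m) * q + t * m * M 1 r s"
      by (simp add: algebra_simps)
    finally have "m \<le> (m - l0) * q + l0 * M 1 r s"
      using \<open>t * m = l0\<close> by simp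
    then have "l0 + (1 - q) * (m - l0) \<le> l0 * M 1 r s"
      by (simp add: algebra_simps)
    moreover have "l0 * (1 + c * s) = l0 + (1 - q) * (m - l0)"
      using l0' by (simp add: c_def eq field_simps)
    ultimately show ?thesis
      using l0' by (metis mult_le_cancel_left_pos)
  qed
  moreover have "c > 0"
    using l0' q by (simp add: c_def)
  ultimately show thesis
    using that by blast
qed

text \<open>On an interval slightly larger than [a, b] the values of \<open>f\<close> lie between 0
  and some \<open>K\<close>, so a step of weight \<open>l\<close> raises \<open>f\<close> by at most
  l * K. It remains to bound such weights by multiples of the distance y - x.\<close>

lemma (in weighted_mean) mean_convex_lipschitz:
  assumes dir: "has_direction Positive M"
    and le: "\<And>u v l. \<lbrakk>u > 0; v > 0; l \<in> {0..1}\<rbrakk> \<Longrightarrow> M u v l \<le> (1 - l) * u + l * v"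
    and I: "is_interval I" "I \<subseteq> {0<..}"
    and f_pos: "\<And>x. x \<in> I \<Longrightarrow> f x > 0"
    and f: "\<And>u v l. \<lbrakk>u \<in> I; v \<in> I; l \<in> {0..1}\<rbrakk> \<Longrightarrow> f (M u v l) \<le> (1 - l) * f u + l * f v"
    and ab: "a \<le> b" "{a..b} \<subseteq> interior I"
  shows "\<exists>L. L-lipschitz_on {a..b} f"
proof -
  have "a \<in> interior I" "b \<in> interior I"
    using ab by auto
  then obtain e1 e2 where e: "e1 > 0" "cball a e1 \<subseteq> I" "e2 > 0" "cball b e2 \<subseteq> I"
    by (meson mem_interior_cball)
  \<comment> \<open>The gaps a - p and w - b stay fixed while x and y vary; they provide the
    denominators of the Lipschitz constant.\<close>
  define p w where "p = a - e1" and "w = b + e2"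
  have "p \<in> cball a e1" "w \<in> cball b e2"
    using e by (auto simp: p_def w_def dist_real_def)
  then have pw: "p \<in> I" "w \<in> I" "p < a" "b < w"
    using e by (auto simp: p_def w_def)
  have sub: "{p..w} \<subseteq> I"
    using mem_is_interval_1_I[OF I(1) pw(1,2)] by auto
  have "0 < p"
    using pw I by auto
  then have a: "0 < a" "0 < b"
    using pw ab by auto
  define K where "K = max (f p) (f w)"
  have K: "0 < f x \<and> f x \<le> K" if x: "x \<in> {p..w}" for x
  proof -
    obtain l where l: "l \<in> {0..1}" "M p w l = x"
      using between_eq_mean[of p w x] x \<open>0 < p\<close> pw ab by auto
    have "f x \<le> (1 - l) * f p + l * f w"
      using f[of p w l] l pw by simp
    also have "\<dots> \<le> K"
      using l by (intro convex_bound_le) (auto simp: K_def)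
    finally show ?thesis
      using f_pos x sub by auto
  qed
  have "0 < K"
    using K[of p] pw ab by auto
  \<comment> \<open>Positivity of \<open>f x\<close> gives f u - f x \<le> K, so no separate lower
    bound on \<open>f\<close> enters.\<close>
  have chord: "f y - f x \<le> l * K"
    if "u \<in> {p..w}" "x \<in> {p..w}" "l \<in> {0..1}" "f y \<le> (1 - l) * f x + l * f u" for u x y l
  proof -
    have "f y - f x \<le> l * (f u - f x)"
      using that(4) by (simp add: algebra_simps)
    also have "\<dots> \<le> l * K"
      using that(3) K[OF that(1)] K[OF that(2)] by (intro mult_left_mono) auto
    finally show ?thesis .
  qed
  \<comment> \<open>With x a mean of \<open>p\<close> and y, the weight on \<open>p\<close> is 1 -
    l, and M \<le> A says exactly (1 - l) * (y - p) \<le> y - x.\<close>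
  have down: "f x - f y \<le> K / (a - p) * (y - x)" if xy: "a \<le> x" "x < y" "y \<le> b" for x y
  proof -
    have y: "0 < p" "p < y" "y \<in> {p..w}" "x \<in> {p..w}"
      using \<open>0 < p\<close> xy pw by auto
    obtain l where l: "l \<in> {0..1}" "M p y l = x"
      using between_eq_mean[of p y x] y xy by auto
    have "f x \<le> (1 - (1 - l)) * f y + (1 - l) * f p"
      using f[of p y l] l pw subsetD[OF sub y(3)] by (simp add: add.commute)
    then have "f x - f y \<le> (1 - l) * K"
      using l y xy pw by (intro chord[of p]) auto
    also have "1 - l \<le> (y - x) / (a - p)"
    proof -
      have "(1 - l) * (a - p) \<le> (1 - l) * (y - p)"
        using l xy by (intro mult_left_mono) auto
      also have "\<dots> \<le> y - x"
        using le[of p y l] l y by (simp add: algebra_simps)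
      finally show ?thesis
        using pw by (simp add: field_simps)
    qed
    then have "(1 - l) * K \<le> (y - x) / (a - p) * K"
      using \<open>0 < K\<close> by (intro mult_right_mono) auto
    finally show ?thesis
      by (simp add: mult_ac)
  qed
  \<comment> \<open>With this ratio r * x \<le> w for every x \<le> b, so r * x can serve as the
    right end of the chord, and one constant \<open>c\<close> fits all x by homogeneity.\<close>
  define r where "r = w / b"
  have r: "r > 1" "r * b = w"
    using pw a by (auto simp: r_def)
  obtain c where c: "c > 0" "\<And>s. s \<in> {0..1} \<Longrightarrow> 1 + c * s \<le> M 1 r s"
    using mean_linear_lower_bound[OF dir le r(1)] by blast
  have up: "f y - f x \<le> (K / (c * a) + K / ((r - 1) * a)) * (y - x)"
    if xy: "a \<le> x" "x < y" "y \<le> b" for x y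
  proof -
    have nonneg: "0 \<le> K / (c * a) * (y - x)" "0 \<le> K / ((r - 1) * a) * (y - x)"
      using \<open>0 < K\<close> c a r xy by auto
    have x: "0 < x" "x \<in> {p..w}" "y \<in> {p..w}"
      using xy pw a by auto
    have "f y - f x \<le> K / (c * a) * (y - x) \<or> f y - f x \<le> K / ((r - 1) * a) * (y - x)"
    \<comment> \<open>If y lies beyond r * x, the distance is at least (r - 1) * a and the crude
      bound f y - f x \<le> K suffices. The two constants are nonnegative, so their sum covers both
      cases.\<close>
    proof (cases "y \<le> r * x")
      case True
      have "r * x \<le> r * b"
        using xy r by (intro mult_left_mono) auto
      then have rx: "x < r * x" "r * x \<in> {p..w}"
        using r x True xy by auto
      obtain l where l: "l \<in> {0..1}" "M x (r * x) l = y"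
        using between_eq_mean[of x "r * x" y] x rx True xy by auto
      have "f y \<le> (1 - l) * f x + l * f (r * x)"
        using f[OF subsetD[OF sub x(2)] subsetD[OF sub rx(2)] l(1)] l(2) by simp
      then have *: "f y - f x \<le> l * K"
        using l x rx by (intro chord[of "r * x"]) auto
      have "y = x * M 1 r l"
        using WM4[of 1 r l x] l r x by (simp add: mult_ac)
      then have "x * (1 + c * l) \<le> y"
        using c(2)[OF l(1)] x by simp
      then have "x * (c * l) \<le> y - x"
        by (simp add: algebra_simps)
      moreover have "a * (c * l) \<le> x * (c * l)"
        using xy l c by (intro mult_right_mono) auto
      ultimately have "l * (c * a) \<le> y - x"
        by (simp add: mult_ac)
      then have "l \<le> (y - x) / (c * a)"
        using c(1) a by (simp add: pos_le_divide_eq)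
      then have "l * K \<le> (y - x) / (c * a) * K"
        using \<open>0 < K\<close> by (intro mult_right_mono) auto
      then show ?thesis
        using * by (simp add: mult_ac)
    next
      case False
      have "(r - 1) * a \<le> (r - 1) * x"
        using r xy by (intro mult_left_mono) auto
      also have "\<dots> \<le> y - x"
        using False by (simp add: algebra_simps)
      finally have "1 \<le> (y - x) / ((r - 1) * a)"
        using r a by simp
      then have "K * 1 \<le> K * ((y - x) / ((r - 1) * a))"
        using \<open>0 < K\<close> by (intro mult_left_mono) auto
      moreover have "f y - f x \<le> K"
        using K[of x] K[of y] x by auto
      ultimately show ?thesis
        by simp
    qed
    then show ?thesis
      using nonneg unfolding distrib_right by linarith
  qed
  define L where "L = K / (a - p) + (K / (c * a) + K / ((r - 1) * a))"
  have L: "0 \<le> K / (a - p)" "0 \<le> K / (c * a) + K / ((r - 1) * a)"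
    using \<open>0 < K\<close> pw c a r by auto
  have less: "\<bar>f x - f y\<bar> \<le> L * (y - x)" if xy: "a \<le> x" "x < y" "y \<le> b" for x y
    using down[OF xy] up[OF xy] mult_nonneg_nonneg[OF L(1), of "y - x"]
      mult_nonneg_nonneg[OF L(2), of "y - x"] xy
    unfolding L_def distrib_right[of "K / (a - p)"] by (simp add: abs_le_iff)
  have "L-lipschitz_on {a..b} f"
  proof (rule lipschitz_onI)
    show "dist (f x) (f y) \<le> L * dist x y" if "x \<in> {a..b}" "y \<in> {a..b}" for x y
      using less[of x y] less[of y x] that
      by (cases x y rule: linorder_cases) (auto simp: dist_real_def abs_minus_commute)
    show "0 \<le> L"
      using L by (simp add: L_def)
  qed
  then show ?thesis ..
qed

section \<open>Consequences of Lipschitz bounds, and the theorem\<close>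

lemma lipschitz_on_imp_absolutely_continuous_on:
  assumes "L-lipschitz_on {a..b} f"
  shows "absolutely_continuous_on a b f"
  unfolding absolutely_continuous_on_def
proof (intro allI impI)
  fix \<epsilon> :: real assume "\<epsilon> > 0"
  have L: "L \<ge> 0"
    using assms by (rule lipschitz_on_nonneg)
  show "\<exists>\<delta>>0. \<forall>(n::nat) s t. (\<forall>k<n. a \<le> s k \<and> s k \<le> t k \<and> t k \<le> b) \<longrightarrow>
       disjoint_family_on (\<lambda>k. {s k<..<t k}) {..<n} \<longrightarrow>
       (\<Sum>k<n. t k - s k) < \<delta> \<longrightarrow> (\<Sum>k<n. \<bar>f (t k) - f (s k)\<bar>) < \<epsilon>"
  \<comment> \<open>Dividing by L + 1 keeps the witness positive and meaningful when L = 0.\<close>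
  proof (intro exI[of _ "\<epsilon> / (L + 1)"] conjI allI impI)
    fix n :: nat and s t
    assume st: "\<forall>k<n. a \<le> s k \<and> s k \<le> t k \<and> t k \<le> b"
      and small: "(\<Sum>k<n. t k - s k) < \<epsilon> / (L + 1)"
    have "(\<Sum>k<n. \<bar>f (t k) - f (s k)\<bar>) \<le> (\<Sum>k<n. (L + 1) * (t k - s k))"
    proof (rule sum_mono)
      fix k assume "k \<in> {..<n}"
      then have k: "a \<le> s k" "s k \<le> t k" "t k \<le> b"
        using st by auto
      have "\<bar>f (t k) - f (s k)\<bar> \<le> L * (t k - s k)"
        using lipschitz_onD[OF assms, of "t k" "s k"] k by (auto simp: dist_real_def)
      also have "\<dots> \<le> (L + 1) * (t k - s k)"
        using k by (intro mult_right_mono) auto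
      finally show "\<bar>f (t k) - f (s k)\<bar> \<le> (L + 1) * (t k - s k)" .
    qed
    also have "\<dots> < \<epsilon>"
      using small L unfolding sum_distrib_left[symmetric]
      by (simp add: pos_less_divide_eq mult.commute)
    finally show "(\<Sum>k<n. \<bar>f (t k) - f (s k)\<bar>) < \<epsilon>" .
  qed (use \<open>\<epsilon> > 0\<close> L in simp)
qed

lemma continuous_on_interior_if_lipschitz_on_subintervals:
  fixes f :: "real \<Rightarrow> real"
  assumes "\<And>a b. \<lbrakk>a \<le> b; {a..b} \<subseteq> interior I\<rbrakk> \<Longrightarrow> \<exists>L. L-lipschitz_on {a..b} f"
  shows "continuous_on (interior I) f"
proof (intro continuous_at_imp_continuous_on ballI)
  fix x assume "x \<in> interior I"
  then obtain e where e: "e > 0" "cball x e \<subseteq> interior I"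
    by (meson open_contains_cball open_interior)
  then obtain L where "L-lipschitz_on {x - e..x + e} f"
    using assms[of "x - e" "x + e"] by (auto simp: cball_eq_atLeastAtMost)
  then have "continuous_on {x - e..x + e} f"
    by (rule lipschitz_on_continuous_on)
  then show "isCont f x"
    using e by (intro continuous_on_interior) auto
qed

theorem theorem5:
  fixes M N :: "real \<Rightarrow> real \<Rightarrow> real \<Rightarrow> real"
    and d :: direction
    and I J :: "real set"
    and f :: "real \<Rightarrow> real"
  assumes "weighted_mean M" and "weighted_mean N"
    and "has_direction d M" and "has_direction d N"
    and "is_interval I" and "I \<subseteq> {0<..}"
    and "is_interval J" and "J \<subseteq> {0<..}"
    and "\<forall>u>0. \<forall>v>0. \<forall>l\<in>{0..1}. M u v l \<le> arith_mean d u v l"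
    and "\<forall>u>0. \<forall>v>0. \<forall>l\<in>{0..1}. N u v l \<le> arith_mean d u v l"
    and "f \<in> I \<rightarrow> J"
    and "MN_convex_on I M N f"
  shows "(\<forall>a b. a \<le> b \<longrightarrow> {a..b} \<subseteq> interior I \<longrightarrow> (\<exists>L. L-lipschitz_on {a..b} f))
    \<and> (\<forall>a b. a \<le> b \<longrightarrow> {a..b} \<subseteq> interior I \<longrightarrow> absolutely_continuous_on a b f)
    \<and> continuous_on (interior I) f"
proof -
  note M = assms(1) and dir = assms(3) and I = assms(5,6)
    and leM = assms(9)[rule_format] and leN = assms(10)[rule_format]
  have f_pos: "f x > 0" if "x \<in> I" for x
    using assms(8,11) that by auto
  \<comment> \<open>N \<le> A is applied at the positive values of \<open>f\<close>, leaving
    convexity from \<open>M\<close> to the arithmetic mean.\<close>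
  have conv: "f (M u v l) \<le> arith_mean d (f u) (f v) l" if "u \<in> I" "v \<in> I" "l \<in> {0..1}" for u v l
  proof -
    have "f (M u v l) \<le> N (f u) (f v) l"
      using assms(12) that by (auto simp: MN_convex_on_def)
    also have "\<dots> \<le> arith_mean d (f u) (f v) l"
      using leN f_pos that by blast
    finally show ?thesis .
  qed
  have lip: "\<exists>L. L-lipschitz_on {a..b} f" if ab: "a \<le> b" "{a..b} \<subseteq> interior I" for a b
  proof (cases d)
    case Positive
    show ?thesis
    proof (rule weighted_mean.mean_convex_lipschitz[OF M _ _ I f_pos _ ab])
      show "has_direction Positive M"
        using dir Positive by simp
    qed (use leM conv Positive in auto)
  next
    case Negative
    show ?thesis
    \<comment> \<open>At weight 1 - l the negative arithmetic mean is the positive one at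
      \<open>l\<close>, so both inequalities carry over to the reversed mean.\<close>
    proof (rule weighted_mean.mean_convex_lipschitz[OF weighted_mean_reverse[OF M] _ _ I f_pos _ ab])
      show "has_direction Positive (\<lambda>u v l. M u v (1 - l))"
        using dir Negative has_direction_reverse by simp
      show "M u v (1 - l) \<le> (1 - l) * u + l * v" if "u > 0" "v > 0" "l \<in> {0..1}" for u v l
        using leM[of u v "1 - l"] that Negative by simp
      show "f (M u v (1 - l)) \<le> (1 - l) * f u + l * f v" if "u \<in> I" "v \<in> I" "l \<in> {0..1}" for u v l
        using conv[of u v "1 - l"] that Negative by simp
    qed
  qed
  then show ?thesis
    using lipschitz_on_imp_absolutely_continuous_on
      continuous_on_interior_if_lipschitz_on_subintervals by blast
qed

end
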